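(* For $f:\mathbb{R}^n\to\mathbb{R}\cup\{+\infty\}$ with $X=\{x\in\mathbb{R}^n:f(x)\neq+\infty\}$, consider the two conditions: (A) $X$ admits a partition $X=\bigsqcup_{i=1}^N X_i$ (with $N\in\mathbb{N}^*\cup\{+\infty\}$) such that, for every $i$, $X_i$ is ample and $f_{|X_i}:X_i\to\mathbb{R}$ is continuous; (B) $X$ admits a partition $X=\bigsqcup_{i=1}^N X_i$ (with $N\in\mathbb{N}^*\cup\{+\infty\}$) such that, for every $i$, $X_i$ has the interior cone property and $f_{|X_i}:X_i\to\mathbb{R}$ is continuous. Then (A) is strictly weaker than (B): for every $n\ge1$ and every such $f$, (B) implies (A); and there exist $n$ and $f$ for which (A) holds but (B) does not.
   Context: A set $S\subseteq\mathbb{R}^n$ is ample if $S\subseteq\mathrm{cl}(\mathrm{int}(S))$. Let $\mathbb{S}^n$ denote the unit sphere of $\mathbb{R}^n$. A set $S\subseteq\mathbb{R}^n$ has the interior cone property (ICP) if for every $x\in\partial S$ (topological boundary) there exist a nonempty set $U\subseteq\mathbb{S}^n$, open in the topology induced on $\mathbb{S}^n$, and an open neighborhood $O$ of $0$ in $\mathbb{R}^n$ such that, with $K=\mathbb{R}_+^*U=\{\lambda u:\lambda>0,u\in U\}$, $K_x=\{x\}+K$ and $O_x=\{x\}+O$, one has $K_x\cap O_x\subseteq S$. *)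

theory Defs
  imports "HOL-Analysis.Analysis" "HOL-Library.Extended_Nat"
begin

text \<open>
  Since the dimension is quantified inside the statement, R^n is the library's
  \<open>Euclidean_space n\<close>: its points are the functions \<open>x :: nat \<Rightarrow> real\<close> with
  \<open>x i = 0\<close> for \<open>i \<ge> n\<close>, and vector operations are written coordinatewise.
\<close>

definition ample :: "nat \<Rightarrow> (nat \<Rightarrow> real) set \<Rightarrow> bool" where
  "ample n S \<longleftrightarrow>
     S \<subseteq> topspace (Euclidean_space n) \<and>
     S \<subseteq> Euclidean_space n closure_of (Euclidean_space n interior_of S)"

text \<open>The unit sphere of R^n is the library's \<open>nsphere (n - 1)\<close> for \<open>n \<ge> 1\<close>;
  the index here is the dimension of the ambient space.\<close>

definition unit_sphere :: "nat \<Rightarrow> (nat \<Rightarrow> real) set" where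
  "unit_sphere n = {x \<in> topspace (Euclidean_space n). (\<Sum>i<n. (x i)\<^sup>2) = 1}"

definition open_ray_cone :: "(nat \<Rightarrow> real) set \<Rightarrow> (nat \<Rightarrow> real) set" where
  "open_ray_cone U = {(\<lambda>i. c * u i) |c u. c > 0 \<and> u \<in> U}"

definition translate :: "(nat \<Rightarrow> real) \<Rightarrow> (nat \<Rightarrow> real) set \<Rightarrow> (nat \<Rightarrow> real) set" where
  "translate x A = {(\<lambda>i. x i + a i) |a. a \<in> A}"

definition interior_cone_property :: "nat \<Rightarrow> (nat \<Rightarrow> real) set \<Rightarrow> bool" where
  "interior_cone_property n S \<longleftrightarrow>
     S \<subseteq> topspace (Euclidean_space n) \<and>
     (\<forall>x \<in> Euclidean_space n frontier_of S.
        \<exists>U V. U \<noteq> {} \<and>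
              openin (subtopology (Euclidean_space n) (unit_sphere n)) U \<and>
              openin (Euclidean_space n) V \<and> (\<lambda>i. 0) \<in> V \<and>
              translate x (open_ray_cone U) \<inter> translate x V \<subseteq> S)"

text \<open>The functions from R^n to the reals extended by plus infinity.  Values off
  \<open>topspace (Euclidean_space n)\<close> are irrelevant.\<close>

definition never_minus_infinity :: "nat \<Rightarrow> ((nat \<Rightarrow> real) \<Rightarrow> ereal) \<Rightarrow> bool" where
  "never_minus_infinity n f \<longleftrightarrow> (\<forall>x \<in> topspace (Euclidean_space n). f x \<noteq> -\<infinity>)"

definition finite_domain :: "nat \<Rightarrow> ((nat \<Rightarrow> real) \<Rightarrow> ereal) \<Rightarrow> (nat \<Rightarrow> real) set" where
  "finite_domain n f = {x \<in> topspace (Euclidean_space n). f x \<noteq> \<infinity>}"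

text \<open>
  The pieces are indexed by \<open>i = 1, ..., N\<close>, or by all \<open>i \<ge> 1\<close> if \<open>N = \<infinity>\<close>; as usual for
  partitions, they are nonempty and pairwise disjoint (injectivity of the indexing
  rules out repeated pieces). On each piece \<open>f\<close> is finite, so \<open>real_of_ereal \<circ> f\<close>
  is there just \<open>f\<close> seen as a real-valued function.
\<close>

definition continuous_partition ::
  "((nat \<Rightarrow> real) set \<Rightarrow> bool) \<Rightarrow> nat \<Rightarrow> ((nat \<Rightarrow> real) \<Rightarrow> ereal) \<Rightarrow> bool" where
  "continuous_partition Q n f \<longleftrightarrow>
     (\<exists>(N :: enat) (P :: nat \<Rightarrow> (nat \<Rightarrow> real) set).
        let I = {i. 1 \<le> i \<and> enat i \<le> N} in
          1 \<le> N \<and>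
          partition_on (finite_domain n f) (P ` I) \<and> inj_on P I \<and>
          (\<forall>i \<in> I. Q (P i) \<and>
             continuous_map (subtopology (Euclidean_space n) (P i)) euclideanreal
               (real_of_ereal \<circ> f)))"

definition ample_piecewise_continuous :: "nat \<Rightarrow> ((nat \<Rightarrow> real) \<Rightarrow> ereal) \<Rightarrow> bool" where
  "ample_piecewise_continuous n f \<longleftrightarrow> continuous_partition (ample n) n f"

definition icp_piecewise_continuous :: "nat \<Rightarrow> ((nat \<Rightarrow> real) \<Rightarrow> ereal) \<Rightarrow> bool" where
  "icp_piecewise_continuous n f \<longleftrightarrow> continuous_partition (interior_cone_property n) n f"

end

theory Submission
  imports Defs
begin

text \<open>
  The interior cone property makes a set ample because a cone over a nonempty open set of
  directions, truncated by a neighbourhood of its apex, is an open set that accumulates at the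
  apex (\<open>openin_translated_cone\<close>). So a boundary point of \<open>S\<close> that lies in \<open>S\<close> is a limit of
  interior points, and a partition into sets with the interior cone property is already a
  partition into ample sets.

  The converse fails: a set with the interior cone property contains a segment issuing from each of its
  points (\<open>icp_contains_segment\<close>), whereas ampleness only asks for interior points nearby. On
  the line, remove the points \<open>1 / (k * \<pi>)\<close>, \<open>k\<close> a nonzero integer: what remains (\<open>slit_line\<close>) is
  an open set together with its limit point \<open>0\<close>, hence ample, but it contains no segment issuing
  from \<open>0\<close>. In any partition of it, the piece that contains \<open>0\<close> contains no such segment either,
  hence lacks the interior cone property. The function that vanishes on this set and is \<open>\<infinity>\<close>
  elsewhere therefore separates the two conditions.
\<close>

section \<open>Segments and cones\<close>

lemma continuous_map_into_Euclidean_space: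
  "continuous_map X (Euclidean_space n) f \<longleftrightarrow>
     (\<forall>i. continuous_map X euclideanreal (\<lambda>x. f x i)) \<and>
     f \<in> topspace X \<rightarrow> topspace (Euclidean_space n)"
  by (auto simp: Euclidean_space_def continuous_map_in_subtopology
      continuous_map_componentwise_UNIV)

lemma continuous_map_Euclidean_space_projection:
  "continuous_map (Euclidean_space n) euclideanreal (\<lambda>x. x i)"
  unfolding Euclidean_space_def
  by (intro continuous_map_from_subtopology continuous_map_product_projection) auto

lemma open_contains_small_steps:
  assumes T: "openin (Euclidean_space n) T" and x: "x \<in> T"
    and u: "u \<in> topspace (Euclidean_space n)"
  obtains e where "e > 0" "\<And>t. \<bar>t\<bar> < e \<Longrightarrow> (\<lambda>i. x i + t * u i) \<in> T"
proof -
  have xs: "x \<in> topspace (Euclidean_space n)"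
    using T x openin_subset by blast
  have "continuous_map euclideanreal (Euclidean_space n) (\<lambda>t i. x i + t * u i)"
    using xs u
    by (auto simp: continuous_map_into_Euclidean_space topspace_Euclidean_space
        intro!: continuous_intros)
  then have "open {t. (\<lambda>i. x i + t * u i) \<in> T}"
    using openin_continuous_map_preimage[OF _ T] by fastforce
  moreover have "0 \<in> {t. (\<lambda>i. x i + t * u i) \<in> T}"
    using x by simp
  ultimately obtain e where "e > 0" "ball 0 e \<subseteq> {t. (\<lambda>i. x i + t * u i) \<in> T}"
    using open_contains_ball by blast
  then show thesis
    by (intro that[of e]) (auto simp: subset_iff)
qed

lemma openin_translate:
  assumes x: "x \<in> topspace (Euclidean_space n)" and V: "openin (Euclidean_space n) V"
  shows "openin (Euclidean_space n) (translate x V)"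
proof -
  have "continuous_map (Euclidean_space n) (Euclidean_space n) (\<lambda>z i. z i - x i)"
    using x by (auto simp: continuous_map_into_Euclidean_space topspace_Euclidean_space
        intro!: continuous_intros continuous_map_Euclidean_space_projection)
  then have "openin (Euclidean_space n)
      {z \<in> topspace (Euclidean_space n). (\<lambda>i. z i - x i) \<in> V}"
    using V by (rule openin_continuous_map_preimage)
  moreover have "{z \<in> topspace (Euclidean_space n). (\<lambda>i. z i - x i) \<in> V} = translate x V"
  proof -
    have "z \<in> translate x V" if "(\<lambda>i. z i - x i) \<in> V" for z
      using that unfolding translate_def by (auto intro!: exI[of _ "\<lambda>i. z i - x i"])
    moreover have "z \<in> topspace (Euclidean_space n) \<and> (\<lambda>i. z i - x i) \<in> V"
      if z: "z \<in> translate x V" for z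
    proof -
      obtain a where a: "a \<in> V" "z = (\<lambda>i. x i + a i)"
        using z unfolding translate_def by blast
      then have "a \<in> topspace (Euclidean_space n)"
        using openin_subset[OF V] by blast
      then show ?thesis
        using a x by (auto simp: topspace_Euclidean_space)
    qed
    ultimately show ?thesis by blast
  qed
  ultimately show ?thesis by simp
qed

text \<open>Away from the origin, the cone over \<open>U\<close> is the preimage of \<open>U\<close> under the radial
  projection to the sphere, which is continuous there.\<close>

lemma openin_open_ray_cone:
  assumes U: "openin (subtopology (Euclidean_space n) (unit_sphere n)) U"
  shows "openin (Euclidean_space n) (open_ray_cone U)"
proof -
  define E where "E = Euclidean_space n"
  define len where "len = (\<lambda>z::nat \<Rightarrow> real. sqrt (\<Sum>i<n. (z i)\<^sup>2))"
  define D where "D = {z \<in> topspace E. len z \<in> {0<..}}"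
  have len_cont: "continuous_map E euclideanreal len"
    unfolding len_def E_def
    by (intro continuous_intros continuous_map_sum continuous_map_real_pow
        continuous_map_Euclidean_space_projection) auto
  have D: "openin E D"
    unfolding D_def by (rule openin_continuous_map_preimage[OF len_cont]) auto
  have U_sphere: "U \<subseteq> unit_sphere n"
    using U openin_imp_subset by blast
  have radial: "continuous_map (subtopology E D) (subtopology E (unit_sphere n)) (\<lambda>z i. z i / len z)"
  proof -
    have "(\<Sum>i<n. (z i / len z)\<^sup>2) = 1" if "z \<in> D" for z
    proof -
      have "(\<Sum>i<n. (z i / len z)\<^sup>2) = (\<Sum>i<n. (z i)\<^sup>2) / (len z)\<^sup>2"
        by (simp add: power_divide sum_divide_distrib)
      also have "\<dots> = 1"
        using that by (auto simp: D_def len_def sum_nonneg)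
      finally show ?thesis .
    qed
    moreover have "continuous_map (subtopology E D) euclideanreal (\<lambda>z. z i / len z)" for i
    proof (rule continuous_map_real_divide)
      show "continuous_map (subtopology E D) euclideanreal (\<lambda>z. z i)"
        unfolding E_def
        by (intro continuous_map_from_subtopology continuous_map_Euclidean_space_projection)
      show "continuous_map (subtopology E D) euclideanreal len"
        using len_cont by (rule continuous_map_from_subtopology)
      show "len z \<noteq> 0" if "z \<in> topspace (subtopology E D)" for z
        using that by (simp add: D_def)
    qed
    moreover have "(\<lambda>z i. z i / len z) \<in> D \<rightarrow> topspace E"
      by (auto simp: D_def E_def topspace_Euclidean_space)
    moreover have "topspace (subtopology E D) = D"
      using openin_subset[OF D] by auto
    ultimately show ?thesis
      by (auto simp: continuous_map_in_subtopology continuous_map_into_Euclidean_space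
          unit_sphere_def E_def Pi_iff)
  qed
  have "openin (subtopology E D) {z \<in> topspace (subtopology E D). (\<lambda>i. z i / len z) \<in> U}"
    using openin_continuous_map_preimage[OF radial] U by (simp add: E_def)
  then have "openin E {z \<in> topspace (subtopology E D). (\<lambda>i. z i / len z) \<in> U}"
    using openin_open_subtopology[OF D] by blast
  moreover have "{z \<in> topspace (subtopology E D). (\<lambda>i. z i / len z) \<in> U} = open_ray_cone U"
  proof -
    have "z \<in> open_ray_cone U" if "z \<in> D" "(\<lambda>i. z i / len z) \<in> U" for z
      using that unfolding open_ray_cone_def D_def
      by (auto intro!: exI[of _ "len z"] exI[of _ "\<lambda>i. z i / len z"])
    moreover have "z \<in> D \<and> (\<lambda>i. z i / len z) \<in> U" if z: "z \<in> open_ray_cone U" for z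
    proof -
      obtain c u where c: "c > 0" and u: "u \<in> U" and z_eq: "z = (\<lambda>i. c * u i)"
        using z unfolding open_ray_cone_def by blast
      have us: "u \<in> topspace E" "(\<Sum>i<n. (u i)\<^sup>2) = 1"
        using u U_sphere by (auto simp: unit_sphere_def E_def)
      have "len z = c"
        using c us by (simp add: len_def z_eq power_mult_distrib flip: sum_distrib_left)
      then show ?thesis
        using c u us by (auto simp: D_def z_eq E_def topspace_Euclidean_space)
    qed
    ultimately show ?thesis
      using openin_subset[OF D] by auto
  qed
  ultimately show ?thesis by (simp add: E_def)
qed

lemma openin_translated_cone:
  assumes "x \<in> topspace (Euclidean_space n)"
    and "openin (subtopology (Euclidean_space n) (unit_sphere n)) U"
    and "openin (Euclidean_space n) V"
  shows "openin (Euclidean_space n) (translate x (open_ray_cone U) \<inter> translate x V)"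
  using assms by (intro openin_Int openin_translate openin_open_ray_cone)

lemma translated_cone_contains_segment:
  assumes u: "u \<in> U" "u \<in> topspace (Euclidean_space n)"
    and V: "openin (Euclidean_space n) V" "(\<lambda>i. 0) \<in> V"
  obtains e where "e > 0"
    "\<And>t. 0 < t \<Longrightarrow> t < e \<Longrightarrow>
       (\<lambda>i. x i + t * u i) \<in> translate x (open_ray_cone U) \<inter> translate x V"
proof -
  obtain e where "e > 0" and e: "\<And>t. \<bar>t\<bar> < e \<Longrightarrow> (\<lambda>i. t * u i) \<in> V"
    using open_contains_small_steps[OF V u(2)] by auto
  then show thesis
    using u(1) by (intro that[of e]) (force simp: translate_def open_ray_cone_def)+
qed

section \<open>The interior cone property implies ampleness\<close>

lemma icp_imp_ample:
  assumes S: "interior_cone_property n S"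
  shows "ample n S"
proof -
  let ?E = "Euclidean_space n"
  have sub: "S \<subseteq> topspace ?E"
    using S by (simp add: interior_cone_property_def)
  have "x \<in> ?E closure_of (?E interior_of S)" if x: "x \<in> S" for x
  proof (cases "x \<in> ?E interior_of S")
    case True
    then show ?thesis
      by (meson closure_of_subset interior_of_subset_topspace subsetD)
  next
    case False
    then have "x \<in> ?E frontier_of S"
      using x sub closure_of_subset by (auto simp: frontier_of_def)
    then obtain U V where "U \<noteq> {}"
      and U: "openin (subtopology ?E (unit_sphere n)) U"
      and V: "openin ?E V" "(\<lambda>i. 0) \<in> V"
      and cone: "translate x (open_ray_cone U) \<inter> translate x V \<subseteq> S" (is "?K \<subseteq> S")
      using S unfolding interior_cone_property_def by blast
    then obtain u where u: "u \<in> U" "u \<in> topspace ?E"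
      using openin_subset[OF U] by auto
    have xs: "x \<in> topspace ?E"
      using x sub by blast
    have K_interior: "?K \<subseteq> ?E interior_of S"
      using interior_of_maximal[OF cone openin_translated_cone[OF xs U V(1)]] .
    obtain e where "e > 0" and e: "\<And>t. 0 < t \<Longrightarrow> t < e \<Longrightarrow> (\<lambda>i. x i + t * u i) \<in> ?K"
      using translated_cone_contains_segment[OF u V, of x] by blast
    have "\<exists>y. y \<in> ?E interior_of S \<and> y \<in> T" if T: "x \<in> T" "openin ?E T" for T
    proof -
      obtain d where "d > 0" and d: "\<And>t. \<bar>t\<bar> < d \<Longrightarrow> (\<lambda>i. x i + t * u i) \<in> T"
        using open_contains_small_steps[OF T(2,1) u(2)] by blast
      define t where "t = min d e / 2"
      have "0 < t" "t < d" "t < e"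
        using \<open>d > 0\<close> \<open>e > 0\<close> by (auto simp: t_def)
      then have "(\<lambda>i. x i + t * u i) \<in> ?K" "(\<lambda>i. x i + t * u i) \<in> T"
        using e[of t] d[of t] by auto
      then show ?thesis
        using K_interior by blast
    qed
    then show ?thesis
      using xs by (auto simp: in_closure_of)
  qed
  then show ?thesis
    using sub by (auto simp: ample_def)
qed

lemma continuous_partition_mono:
  assumes "continuous_partition Q n f" and QR: "\<And>S. Q S \<Longrightarrow> R S"
  shows "continuous_partition R n f"
proof -
  obtain N :: enat and P where "1 \<le> N"
    and "partition_on (finite_domain n f) (P ` {i. 1 \<le> i \<and> enat i \<le> N})"
    and "inj_on P {i. 1 \<le> i \<and> enat i \<le> N}"
    and "\<forall>i \<in> {i. 1 \<le> i \<and> enat i \<le> N}. Q (P i) \<and>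
      continuous_map (subtopology (Euclidean_space n) (P i)) euclideanreal (real_of_ereal \<circ> f)"
    using assms(1) unfolding continuous_partition_def Let_def by auto
  then show ?thesis
    unfolding continuous_partition_def Let_def
    by (intro exI[of _ N] exI[of _ P]) (simp add: QR)
qed

lemma continuous_partition_piece_of_point:
  assumes "continuous_partition Q n f" and "x \<in> finite_domain n f"
  obtains S where "Q S" "S \<subseteq> finite_domain n f" "x \<in> S"
proof -
  obtain N :: enat and P
    where part: "partition_on (finite_domain n f) (P ` {i. 1 \<le> i \<and> enat i \<le> N})"
    and Q: "\<forall>i \<in> {i. 1 \<le> i \<and> enat i \<le> N}. Q (P i)"
    using assms(1) unfolding continuous_partition_def Let_def by auto
  have "\<Union> (P ` {i. 1 \<le> i \<and> enat i \<le> N}) = finite_domain n f"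
    using part by (simp add: partition_on_def)
  then obtain i where "i \<in> {i. 1 \<le> i \<and> enat i \<le> N}" "x \<in> P i" "P i \<subseteq> finite_domain n f"
    using assms(2) by blast
  then show thesis
    using Q that by blast
qed

section \<open>An ample set without segments at the origin\<close>

text \<open>At a boundary point the segment lies in the cone; at an interior point any direction will do,
  and \<open>1 \<le> n\<close> guarantees that there is one.\<close>

lemma icp_contains_segment:
  assumes S: "interior_cone_property n S" and x: "x \<in> S" and n: "1 \<le> n"
  obtains u e where "u \<in> unit_sphere n" "e > 0"
    "\<And>t. 0 < t \<Longrightarrow> t < e \<Longrightarrow> (\<lambda>i. x i + t * u i) \<in> S"
proof (cases "x \<in> Euclidean_space n interior_of S")
  case True
  define u :: "nat \<Rightarrow> real" where "u = (\<lambda>i. if i = 0 then 1 else 0)"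
  have "(\<Sum>i<n. (u i)\<^sup>2) = (\<Sum>i<n. if i = 0 then 1 else 0)"
    by (rule sum.cong) (auto simp: u_def)
  then have u: "u \<in> unit_sphere n"
    using n by (auto simp: unit_sphere_def u_def topspace_Euclidean_space)
  then have "u \<in> topspace (Euclidean_space n)"
    by (simp add: unit_sphere_def)
  then obtain e where "e > 0"
    and e: "\<And>t. \<bar>t\<bar> < e \<Longrightarrow> (\<lambda>i. x i + t * u i) \<in> Euclidean_space n interior_of S"
    using open_contains_small_steps[OF openin_interior_of True] by blast
  then show thesis
    using interior_of_subset[of "Euclidean_space n" S] by (intro that[OF u \<open>e > 0\<close>]) auto
next
  case False
  then have "x \<in> Euclidean_space n frontier_of S"
    using x S closure_of_subset by (fastforce simp: frontier_of_def interior_cone_property_def)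
  then obtain U V where "U \<noteq> {}"
    and U: "openin (subtopology (Euclidean_space n) (unit_sphere n)) U"
    and V: "openin (Euclidean_space n) V" "(\<lambda>i. 0) \<in> V"
    and cone: "translate x (open_ray_cone U) \<inter> translate x V \<subseteq> S"
    using S unfolding interior_cone_property_def by blast
  then obtain u where u: "u \<in> U" "u \<in> topspace (Euclidean_space n)" "u \<in> unit_sphere n"
    using openin_subset[OF U] by auto
  obtain e where "e > 0" and e: "\<And>t. 0 < t \<Longrightarrow> t < e \<Longrightarrow>
      (\<lambda>i. x i + t * u i) \<in> translate x (open_ray_cone U) \<inter> translate x V"
    using translated_cone_contains_segment[OF u(1,2) V, of x] by blast
  show thesis
  proof (rule that[OF u(3) \<open>e > 0\<close>])
    show "(\<lambda>i. x i + t * u i) \<in> S" if "0 < t" "t < e" for t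
      using e[OF that] cone by (rule subsetD[rotated])
  qed
qed

text \<open>The line without the reciprocals of the nonzero multiples of \<open>\<pi>\<close>. The origin has to be
  named as a member: it would otherwise be excluded, since \<open>1 / 0 = 0\<close> and \<open>sin 0 = 0\<close>.\<close>

definition slit_line :: "(nat \<Rightarrow> real) set" where
  "slit_line = {x \<in> topspace (Euclidean_space 1). x 0 = 0 \<or> sin (1 / x 0) \<noteq> 0}"

text \<open>In both uses below, \<open>b = \<pi>\<close>, and \<open>a\<close> selects the zeros or the extrema of the sine.\<close>

lemma exists_small_reciprocal_translate:
  fixes a b e :: real
  assumes "b > 0" "e > 0"
  obtains k :: nat where "a + real k * b > 0" "1 / (a + real k * b) < e"
proof -
  obtain k :: nat where k: "(1 / e - a) / b < real k"
    using reals_Archimedean2 by blast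
  then have *: "1 / e < a + real k * b"
    using assms by (simp add: field_simps)
  moreover have "0 < 1 / e"
    using assms by simp
  ultimately have pos: "a + real k * b > 0"
    by linarith
  show thesis
    using that[OF pos] * pos assms by (simp add: field_simps)
qed

text \<open>All points other than the origin are interior points. The origin is the limit of the points
  \<open>1 / (\<pi> / 2 + k * \<pi>)\<close>, where the sine of the reciprocal is \<open>1\<close> or \<open>-1\<close>.\<close>

lemma slit_line_ample: "ample 1 slit_line"
proof -
  let ?E = "Euclidean_space 1"
  let ?G = "{x \<in> topspace ?E. x 0 \<in> {t. t \<noteq> 0 \<and> sin (1 / t) \<noteq> 0}}"
  have "open ((- {0}) \<inter> (\<lambda>t::real. sin (1 / t)) -` (- {0}))"
    by (intro continuous_open_preimage continuous_intros) auto
  moreover have "(- {0}) \<inter> (\<lambda>t::real. sin (1 / t)) -` (- {0}) = {t. t \<noteq> 0 \<and> sin (1 / t) \<noteq> 0}"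
    by auto
  ultimately have "open {t::real. t \<noteq> 0 \<and> sin (1 / t) \<noteq> 0}"
    by simp
  then have "openin ?E ?G"
    by (intro openin_continuous_map_preimage[OF continuous_map_Euclidean_space_projection]) simp
  moreover have "?G \<subseteq> slit_line"
    by (auto simp: slit_line_def)
  ultimately have G: "?G \<subseteq> ?E interior_of slit_line"
    by (rule interior_of_maximal[rotated])
  have "x \<in> ?E closure_of ?G" if x: "x \<in> slit_line" for x
    unfolding in_closure_of
  proof (intro conjI allI impI)
    show "x \<in> topspace ?E"
      using x by (simp add: slit_line_def)
    fix T assume T: "x \<in> T \<and> openin ?E T"
    show "\<exists>y. y \<in> ?G \<and> y \<in> T"
    proof (cases "x 0 = 0")
      case False
      then show ?thesis
        using x T by (auto simp: slit_line_def)
    next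
      case True
      define u :: "nat \<Rightarrow> real" where "u = (\<lambda>i. if i = 0 then 1 else 0)"
      have u: "u \<in> topspace ?E"
        by (simp add: u_def topspace_Euclidean_space)
      obtain e where "e > 0" and e: "\<And>t. \<bar>t\<bar> < e \<Longrightarrow> (\<lambda>i. x i + t * u i) \<in> T"
        using open_contains_small_steps[OF _ _ u] T by blast
      obtain k :: nat where k: "pi / 2 + real k * pi > 0"
          "1 / (pi / 2 + real k * pi) < e"
        using exists_small_reciprocal_translate[of pi e "pi / 2"] \<open>e > 0\<close> by auto
      define t where "t = 1 / (pi / 2 + real k * pi)"
      have "sin (1 / t) \<noteq> 0"
        by (simp add: t_def sin_add)
      moreover have "t > 0" "t < e"
        using k by (auto simp: t_def)
      moreover have "x \<in> topspace ?E"
        using x by (simp add: slit_line_def)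
      ultimately have "(\<lambda>i. x i + t * u i) \<in> ?G" "(\<lambda>i. x i + t * u i) \<in> T"
        using True e[of t] by (auto simp: u_def topspace_Euclidean_space)
      then show ?thesis by blast
    qed
  qed
  then have "slit_line \<subseteq> ?E closure_of (?E interior_of slit_line)"
    using closure_of_mono[OF G] by blast
  moreover have "slit_line \<subseteq> topspace ?E"
    unfolding slit_line_def by blast
  ultimately show ?thesis
    unfolding ample_def by blast
qed

text \<open>A segment issuing from the origin, in either of the two directions of the line, meets one of
  the removed points \<open>1 / (k * \<pi>)\<close> and \<open>-1 / (k * \<pi>)\<close> for \<open>k\<close> large.\<close>

lemma icp_subset_of_slit_line_avoids_origin:
  assumes S: "interior_cone_property 1 S" and sub: "S \<subseteq> slit_line"
  shows "(\<lambda>i. 0) \<notin> S"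
proof
  assume "(\<lambda>i. 0) \<in> S"
  then obtain u e where u: "u \<in> unit_sphere 1" and "e > 0"
    and e: "\<And>t. 0 < t \<Longrightarrow> t < e \<Longrightarrow> (\<lambda>i. t * u i) \<in> S"
    using icp_contains_segment[OF S, of "\<lambda>i. 0"] by auto
  \<comment> \<open>The shift by \<open>pi\<close> rules out the zero multiple.\<close>
  obtain k :: nat where k: "pi + real k * pi > 0" "1 / (pi + real k * pi) < e"
    using exists_small_reciprocal_translate[of pi e pi] \<open>e > 0\<close> by auto
  define t where "t = 1 / (pi + real k * pi)"
  have "t > 0" "t < e"
    using k by (auto simp: t_def)
  then have "(\<lambda>i. t * u i) \<in> slit_line"
    using e sub by blast
  moreover have "u 0 = 1 \<or> u 0 = -1"
    using u by (simp add: unit_sphere_def power2_eq_1_iff)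
  moreover have "sin (1 / t) = 0"
    by (simp add: t_def sin_add)
  ultimately show False
    using \<open>t > 0\<close> by (auto simp: slit_line_def)
qed

theorem proposition5:
  shows "(\<forall>n::nat. \<forall>f :: (nat \<Rightarrow> real) \<Rightarrow> ereal.
            1 \<le> n \<longrightarrow> never_minus_infinity n f \<longrightarrow>
            icp_piecewise_continuous n f \<longrightarrow> ample_piecewise_continuous n f)
       \<and> (\<exists>n::nat. \<exists>f :: (nat \<Rightarrow> real) \<Rightarrow> ereal.
            1 \<le> n \<and> never_minus_infinity n f \<and>
            ample_piecewise_continuous n f \<and> \<not> icp_piecewise_continuous n f)"
proof (rule conjI)
  show "\<forall>n::nat. \<forall>f :: (nat \<Rightarrow> real) \<Rightarrow> ereal.
            1 \<le> n \<longrightarrow> never_minus_infinity n f \<longrightarrow>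
            icp_piecewise_continuous n f \<longrightarrow> ample_piecewise_continuous n f"
  proof (intro allI impI)
    fix n :: nat and f :: "(nat \<Rightarrow> real) \<Rightarrow> ereal"
    assume "icp_piecewise_continuous n f"
    then show "ample_piecewise_continuous n f"
      unfolding icp_piecewise_continuous_def ample_piecewise_continuous_def
      by (rule continuous_partition_mono) (rule icp_imp_ample)
  qed
next
  define f :: "(nat \<Rightarrow> real) \<Rightarrow> ereal" where "f = (\<lambda>x. if x \<in> slit_line then 0 else \<infinity>)"
  have dom: "finite_domain 1 f = slit_line"
    by (auto simp: finite_domain_def f_def slit_line_def)
  have origin: "(\<lambda>i. 0) \<in> slit_line"
    by (simp add: slit_line_def topspace_Euclidean_space)
  have "never_minus_infinity 1 f"
    by (simp add: never_minus_infinity_def f_def)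
  moreover have "ample_piecewise_continuous 1 f"
  proof -
    have I: "{i. 1 \<le> i \<and> enat i \<le> 1} = {1}"
      by (auto simp: one_enat_def)
    have "real_of_ereal \<circ> f = (\<lambda>x. 0)"
      by (auto simp: f_def)
    then have "continuous_map (subtopology (Euclidean_space 1) slit_line) euclideanreal
        (real_of_ereal \<circ> f)"
      by simp
    moreover have "partition_on slit_line {slit_line}"
      using origin by (auto intro: partition_on_space)
    ultimately show ?thesis
      unfolding ample_piecewise_continuous_def continuous_partition_def dom Let_def
      using slit_line_ample
      by (intro exI[where x = "1::enat"] exI[where x = "\<lambda>_. slit_line"]) (simp only: I, simp)
  qed
  moreover have "\<not> icp_piecewise_continuous 1 f"
  proof
    assume "icp_piecewise_continuous 1 f"
    then have "continuous_partition (interior_cone_property 1) 1 f"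
      by (simp add: icp_piecewise_continuous_def)
    then show False
    proof (rule continuous_partition_piece_of_point)
      show "(\<lambda>i. 0) \<in> finite_domain 1 f"
        using origin dom by simp
      fix S assume "interior_cone_property 1 S" "S \<subseteq> finite_domain 1 f" "(\<lambda>i. 0) \<in> S"
      then show False
        using icp_subset_of_slit_line_avoids_origin dom by simp
    qed
  qed
  ultimately show "\<exists>n::nat. \<exists>f :: (nat \<Rightarrow> real) \<Rightarrow> ereal.
            1 \<le> n \<and> never_minus_infinity n f \<and>
            ample_piecewise_continuous n f \<and> \<not> icp_piecewise_continuous n f"
    using order_refl[of "1::nat"] by (intro exI[of _ "1::nat"] exI[of _ f] conjI)
qed

end
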